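(* Let $n\ge1$, $p=(p_1,p_2)\in\mathbb{R}^2$, and let $B=(B_1,B_2)$ be a pair of commuting real $n\times n$ matrices such that the matrices $M_k=\mathrm{diag}(p_k,B_k,0)\in M_{n+2}(\mathbb{R})$, $k=1,2$, satisfy (M1) $M_1,M_2$ are linearly independent, and (M2) no nonzero element of $\mathrm{span}(M_1,M_2)$ is similar to a skew-symmetric matrix. Then the subrepresentations $\mu_+$ and $\mu_-$ of the metaplectic representation $\mu$ of $G_{p,B}$ are both (unitarily) equivalent to the subrepresentation $\hat\pi_+$ of the wavelet representation $\hat\pi$ of $G_{p,B}$.
   Context: For $t=(t_1,t_2)^T\in\mathbb{R}^2$ write $pt=p_1t_1+p_2t_2$, $Bt=B_1t_1+B_2t_2$, and $\delta(t)=\det(e^{Bt})$. The group $G_{p,B}$ consists of elements $g(t,x,y,z)$ with $t\in\mathbb{R}^2$, $x,y\in\mathbb{R}^n$, $z\in\mathbb{R}$ (topology of $\mathbb{R}^{2n+3}$), with group law $$g(t,x,y,z)\,g(\tilde t,\tilde x,\tilde y,\tilde z)=g\bigl(t+\tilde t,\;x+e^{Bt}\tilde x,\;y+e^{pt}[e^{-Bt}]^{T}\tilde y,\;z+e^{pt}\tilde z+y^{T}e^{Bt}\tilde x\bigr).$$ Vectors in $\mathbb{R}^n$ are columns; $\widehat{\mathbb{R}^{n}}$ denotes the space of row vectors. Wavelet representation (in Fourier space): $G_{p,B}$ is isomorphic to the subgroup $\mathbb{R}^{n+1}\rtimes H_{p,B}$ of the affine group, with $H_{p,B}=\left\{\begin{bmatrix}e^{pt}&y^Te^{Bt}\\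 0&e^{Bt}\end{bmatrix}\right\}$, and $\hat\pi$ is the unitary representation on $L^2(\widehat{\mathbb{R}^{n+1}})$ given by $$[\hat\pi(g(t,x,y,z))f](r,\xi)=\delta(t)^{1/2}e^{pt/2}e^{-2i\pi(rz+\xi x)}f\bigl(re^{pt},(ry^T+\xi)e^{Bt}\bigr),\qquad r\in\mathbb{R},\ \xi\in\widehat{\mathbb{R}^n}.$$ The subspaces $L^2(\mathcal{O}_\pm)$, where $\mathcal{O}_+=\{(r,\xi):r>0\}$ and $\mathcal{O}_-=\{(r,\xi):r<0\}$, are $\hat\pi$-invariant; $\hat\pi_\pm$ denotes the restriction of $\hat\pi$ to $L^2(\mathcal{O}_\pm)$. Metaplectic representation: $G_{p,B}$ is isomorphic to the closed subgroup of $Sp(n+1,\mathbb{R})$ of matrices $\begin{bmatrix}a&0\\ ma&(a^{-1})^T\end{bmatrix}$ with $m=\begin{bmatrix}-z&-x^T\\ -x&0\end{bmatrix}$ and $a=\begin{bmatrix}1&0\\ -\frac12y&I_n\end{bmatrix}\begin{bmatrix}e^{-pt/2}&0\\ 0&e^{pt/2}[e^{-Bt}]^T\end{bmatrix}$, and $\mu$ is the restriction of the metaplectic representation to this subgroup: the unitary representation on $L^2(\mathbb{R}^{n+1})$ given by $(\mu(g(t,x,y,z))f)(q)=e^{i\pi q^Tmq}|\det a|^{-1/2}f(a^{-1}q)$, that is, $$[\mu(g(t,x,y,z))f]\begin{pmatrix}u\\ v\end{pmatrix}=\delta(t)^{1/2}e^{pt(1-n)/4}e^{-i\pi(u^2z+2uv^Tx)}f\begin{pmatrix}e^{pt/2}u\\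 e^{-pt/2}[e^{Bt}]^T\bigl(\frac u2y+v\bigr)\end{pmatrix},\qquad u\in\mathbb{R},\ v\in\mathbb{R}^n.$$ The subspaces $L^2(\mathcal{U}_\pm)$, where $\mathcal{U}_+=\{\binom uv\in\mathbb{R}^{n+1}:u>0\}$ and $\mathcal{U}_-=\{\binom uv\in\mathbb{R}^{n+1}:u<0\}$, are $\mu$-invariant; $\mu_\pm$ denotes the restriction of $\mu$ to $L^2(\mathcal{U}_\pm)$. *)

theory Defs
  imports "HOL-Analysis.Analysis" "HOL-Algebra.Group"
begin

section \<open>Matrices\<close>

text \<open>Multiplication \<open>*\<close> on the type of matrices is componentwise, so the library exponential is
  not the matrix exponential; we use the power series with respect to \<open>**\<close>.\<close>

definition matrix_exp :: "real^'n^'n \<Rightarrow> real^'n^'n" where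
  "matrix_exp A = (\<Sum>k. (1 / fact k) *\<^sub>R (((**) A ^^ k) (mat 1)))"

definition similar_matrices :: "real^'m^'m \<Rightarrow> real^'m^'m \<Rightarrow> bool" where
  "similar_matrices A S \<longleftrightarrow> (\<exists>P. invertible P \<and> A = P ** S ** matrix_inv P)"

definition skew_symmetric :: "real^'m^'m \<Rightarrow> bool" where
  "skew_symmetric S \<longleftrightarrow> transpose S = - S"

text \<open>The block diagonal matrix \<open>diag(c, A, 0)\<close> of size \<open>n + 2\<close>; its rows and columns are indexed
  by \<open>unit + 'n + unit\<close>, in this order.\<close>

definition block_diag :: "real \<Rightarrow> real^'n^'n \<Rightarrow> real^(unit + 'n + unit)^(unit + 'n + unit)" where
  "block_diag c A = (\<chi> i j. case (i, j) of
      (Inl _, Inl _) \<Rightarrow> c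
    | (Inr (Inl k), Inr (Inl l)) \<Rightarrow> A $ k $ l
    | _ \<Rightarrow> 0)"

definition cond_M1 :: "real^2 \<Rightarrow> real^'n^'n^2 \<Rightarrow> bool" where
  "cond_M1 p B \<longleftrightarrow>
     block_diag (p $ 1) (B $ 1) \<noteq> block_diag (p $ 2) (B $ 2) \<and>
     independent {block_diag (p $ 1) (B $ 1), block_diag (p $ 2) (B $ 2)}"

definition cond_M2 :: "real^2 \<Rightarrow> real^'n^'n^2 \<Rightarrow> bool" where
  "cond_M2 p B \<longleftrightarrow>
     (\<forall>M \<in> span {block_diag (p $ 1) (B $ 1), block_diag (p $ 2) (B $ 2)}.
        M \<noteq> 0 \<longrightarrow> \<not> (\<exists>S. skew_symmetric S \<and> similar_matrices M S))"


section \<open>The group $G_{p,B}$\<close>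

text \<open>Throughout, $pt$ is the inner product \<open>p \<bullet> t\<close>, and \<open>lin_comb B t\<close> is $Bt$.\<close>

definition lin_comb :: "real^'n^'n^2 \<Rightarrow> real^2 \<Rightarrow> real^'n^'n" where
  "lin_comb B t = t $ 1 *\<^sub>R B $ 1 + t $ 2 *\<^sub>R B $ 2"

definition delta :: "real^'n^'n^2 \<Rightarrow> real^2 \<Rightarrow> real" where
  "delta B t = det (matrix_exp (lin_comb B t))"

type_synonym 'n gelem = "(real^2) \<times> (real^'n) \<times> (real^'n) \<times> real"

definition group_G :: "real^2 \<Rightarrow> real^'n^'n^2 \<Rightarrow> 'n gelem monoid" where
  "group_G p B = \<lparr>carrier = UNIV,
     mult = (\<lambda>(t, x, y, z) (t', x', y', z').
       (t + t',
        x + matrix_exp (lin_comb B t) *v x',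
        y + exp (p \<bullet> t) *\<^sub>R (transpose (matrix_exp (- lin_comb B t)) *v y'),
        z + exp (p \<bullet> t) * z' + y \<bullet> (matrix_exp (lin_comb B t) *v x'))),
     one = (0, 0, 0, 0)\<rparr>"


section \<open>The Hilbert space $L^2$\<close>

text \<open>Elements of $L^2$ are classes of square integrable Borel functions modulo equality almost
  everywhere.\<close>

definition square_integrable :: "('a::euclidean_space \<Rightarrow> complex) set" where
  "square_integrable =
     {f \<in> borel_measurable lborel. integrable lborel (\<lambda>x. (norm (f x))\<^sup>2)}"

definition ae_eq :: "(('a::euclidean_space \<Rightarrow> complex) \<times> ('a \<Rightarrow> complex)) set" where
  "ae_eq = {(f, g). f \<in> square_integrable \<and> g \<in> square_integrable \<and> (AE x in lborel. f x = g x)}"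

type_synonym 'a l2 = "('a \<Rightarrow> complex) set"

definition L2 :: "'a::euclidean_space l2 set" where
  "L2 = square_integrable // ae_eq"

definition l2_class :: "('a::euclidean_space \<Rightarrow> complex) \<Rightarrow> 'a l2" where
  "l2_class f = ae_eq `` {f}"

definition l2_rep :: "'a::euclidean_space l2 \<Rightarrow> 'a \<Rightarrow> complex" where
  "l2_rep F = (SOME f. f \<in> F)"

definition l2_add :: "'a::euclidean_space l2 \<Rightarrow> 'a l2 \<Rightarrow> 'a l2" where
  "l2_add F G = l2_class (\<lambda>x. l2_rep F x + l2_rep G x)"

definition l2_scale :: "complex \<Rightarrow> 'a::euclidean_space l2 \<Rightarrow> 'a l2" where
  "l2_scale c F = l2_class (\<lambda>x. c * l2_rep F x)"

definition l2_inner :: "'a::euclidean_space l2 \<Rightarrow> 'a l2 \<Rightarrow> complex" where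
  "l2_inner F G = (LINT x|lborel. l2_rep F x * cnj (l2_rep G x))"

text \<open>The subspace $L^2(S)$ of the classes that vanish almost everywhere outside \<open>S\<close>.\<close>

definition L2_on :: "'a::euclidean_space set \<Rightarrow> 'a l2 set" where
  "L2_on S = {F \<in> L2. \<forall>f \<in> F. AE x in lborel. x \<notin> S \<longrightarrow> f x = 0}"

text \<open>The operator on classes given by an operator on functions. It is applied below only to
  operators that preserve square integrability and equality almost everywhere (weighted
  compositions with invertible linear maps), where the choice of representative is immaterial.\<close>

definition l2_lift ::
  "(('a::euclidean_space \<Rightarrow> complex) \<Rightarrow> ('a \<Rightarrow> complex)) \<Rightarrow> 'a l2 \<Rightarrow> 'a l2" where
  "l2_lift T F = l2_class (T (l2_rep F))"

definition unitary_between ::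
  "'a::euclidean_space l2 set \<Rightarrow> 'b::euclidean_space l2 set \<Rightarrow> ('a l2 \<Rightarrow> 'b l2) \<Rightarrow> bool" where
  "unitary_between H K U \<longleftrightarrow>
     bij_betw U H K \<and>
     (\<forall>F \<in> H. \<forall>G \<in> H. U (l2_add F G) = l2_add (U F) (U G)) \<and>
     (\<forall>c. \<forall>F \<in> H. U (l2_scale c F) = l2_scale c (U F)) \<and>
     (\<forall>F \<in> H. \<forall>G \<in> H. l2_inner (U F) (U G) = l2_inner F G)"

text \<open>The invariance conditions make \<open>\<rho>\<close> and \<open>\<sigma>\<close> act on the subspaces \<open>H\<close> and \<open>K\<close>, so
  that the intertwining relation only involves values of \<open>U\<close> on \<open>H\<close>.\<close>

definition unitarily_equivalent ::
  "('g, 'm) monoid_scheme \<Rightarrow>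
   'a::euclidean_space l2 set \<Rightarrow> ('g \<Rightarrow> 'a l2 \<Rightarrow> 'a l2) \<Rightarrow>
   'b::euclidean_space l2 set \<Rightarrow> ('g \<Rightarrow> 'b l2 \<Rightarrow> 'b l2) \<Rightarrow> bool" where
  "unitarily_equivalent G H \<rho> K \<sigma> \<longleftrightarrow>
     (\<forall>g \<in> carrier G. \<rho> g \<in> H \<rightarrow> H \<and> \<sigma> g \<in> K \<rightarrow> K) \<and>
     (\<exists>U. unitary_between H K U \<and> (\<forall>g \<in> carrier G. \<forall>F \<in> H. U (\<rho> g F) = \<sigma> g (U F)))"


section \<open>The wavelet and the metaplectic representation\<close>

text \<open>The space \<open>real \<times> (real^'n)\<close> models $\mathbb{R}^{n+1}$, as row vectors $(r, \xi)$ for the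
  wavelet representation and as column vectors $(u, v)^T$ for the metaplectic one; row vectors
  are multiplied by matrices from the right with \<open>v*\<close>.\<close>

definition wavelet_fun ::
  "real^2 \<Rightarrow> real^'n^'n^2 \<Rightarrow> 'n gelem \<Rightarrow>
   (real \<times> (real^'n) \<Rightarrow> complex) \<Rightarrow> (real \<times> (real^'n) \<Rightarrow> complex)" where
  "wavelet_fun p B = (\<lambda>(t, x, y, z) f (r, \<xi>).
     complex_of_real (sqrt (delta B t) * exp ((p \<bullet> t) / 2)) *
     exp (- 2 * \<i> * complex_of_real pi * complex_of_real (r * z + \<xi> \<bullet> x)) *
     f (r * exp (p \<bullet> t), (r *\<^sub>R y + \<xi>) v* matrix_exp (lin_comb B t)))"

definition wavelet_rep ::
  "real^2 \<Rightarrow> real^'n^'n^2 \<Rightarrow> 'n gelem \<Rightarrow> (real \<times> (real^'n)) l2 \<Rightarrow> (real \<times> (real^'n)) l2" where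
  "wavelet_rep p B g = l2_lift (wavelet_fun p B g)"

definition metaplectic_fun ::
  "real^2 \<Rightarrow> real^'n^'n^2 \<Rightarrow> 'n gelem \<Rightarrow>
   (real \<times> (real^'n) \<Rightarrow> complex) \<Rightarrow> (real \<times> (real^'n) \<Rightarrow> complex)" where
  "metaplectic_fun p B = (\<lambda>(t, x, y, z) f (u, v).
     complex_of_real (sqrt (delta B t) * exp ((p \<bullet> t) * (1 - real CARD('n)) / 4)) *
     exp (- \<i> * complex_of_real pi * complex_of_real (u\<^sup>2 * z + 2 * u * (v \<bullet> x))) *
     f (exp ((p \<bullet> t) / 2) * u,
        exp (- (p \<bullet> t) / 2) *\<^sub>R
          (transpose (matrix_exp (lin_comb B t)) *v ((u / 2) *\<^sub>R y + v))))"

definition metaplectic_rep ::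
  "real^2 \<Rightarrow> real^'n^'n^2 \<Rightarrow> 'n gelem \<Rightarrow> (real \<times> (real^'n)) l2 \<Rightarrow> (real \<times> (real^'n)) l2" where
  "metaplectic_rep p B g = l2_lift (metaplectic_fun p B g)"

text \<open>\<open>pos_half\<close> is both $\mathcal{O}_+$ and $\mathcal{U}_+$; \<open>neg_half\<close> is $\mathcal{U}_-$.\<close>

definition pos_half :: "(real \<times> (real^'n)) set" where
  "pos_half = {(u, v). u > 0}"

definition neg_half :: "(real \<times> (real^'n)) set" where
  "neg_half = {(u, v). u < 0}"

definition subrep :: "('g \<Rightarrow> 'h \<Rightarrow> 'h) \<Rightarrow> 'h set \<Rightarrow> 'g \<Rightarrow> 'h \<Rightarrow> 'h" where
  "subrep \<rho> H = (\<lambda>g. restrict (\<rho> g) H)"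

abbreviation wavelet_pos ::
  "real^2 \<Rightarrow> real^'n^'n^2 \<Rightarrow> 'n gelem \<Rightarrow> (real \<times> (real^'n)) l2 \<Rightarrow> (real \<times> (real^'n)) l2" where
  "wavelet_pos p B \<equiv> subrep (wavelet_rep p B) (L2_on pos_half)"

abbreviation metaplectic_pos ::
  "real^2 \<Rightarrow> real^'n^'n^2 \<Rightarrow> 'n gelem \<Rightarrow> (real \<times> (real^'n)) l2 \<Rightarrow> (real \<times> (real^'n)) l2" where
  "metaplectic_pos p B \<equiv> subrep (metaplectic_rep p B) (L2_on pos_half)"

abbreviation metaplectic_neg ::
  "real^2 \<Rightarrow> real^'n^'n^2 \<Rightarrow> 'n gelem \<Rightarrow> (real \<times> (real^'n)) l2 \<Rightarrow> (real \<times> (real^'n)) l2" where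
  "metaplectic_neg p B \<equiv> subrep (metaplectic_rep p B) (L2_on neg_half)"

end

theory Submission
  imports Defs
begin

text \<open>
  Substituting $r = u^2/2$ and $\xi = u v$ in the wavelet representation produces the metaplectic
  one on each half-space. The phase $e^{-2 i \pi (rz + \xi x)}$ becomes $e^{-i\pi(u^2 z + 2 u v^T x)}$; the map
  $(u, v) \mapsto (e^{pt/2} u,\, e^{-pt/2} [e^{Bt}]^T(\frac{u}{2} y + v))$ turns into
  $(r, \xi) \mapsto (r e^{pt},\, (r y^T + \xi) e^{Bt})$; and the substitution maps each of
  $\mathcal{U}_+$ and $\mathcal{U}_-$ bijectively onto $\mathcal{O}_+$, with Jacobian $|u|^{n+1}$.
  Hence $f \mapsto |u|^{-(n+1)/2} f(u, v)$, with $(u, v)$ expressed through $(r, \xi)$, is unitary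
  from $L^2(\mathcal{U}_\pm)$ onto $L^2(\mathcal{O}_+)$. It intertwines $\mu_\pm$ with
  $\hat\pi_+$, since $|e^{pt/2}u|^{-(n+1)/2}$ accounts for the difference between the normalizing
  factors $e^{pt(1-n)/4}$ and $e^{pt/2}$.

  All operators involved are weighted compositions $f \mapsto w \cdot (f \circ \varphi)$. A bound on
  $\int |w|^2\, (g \circ \varphi)$ by a multiple of $\int g$, for nonnegative \<open>g\<close>, makes them act
  on classes modulo null sets (\<open>l2_lift_class\<close>). For the representations it follows from
  \<open>nn_integral_lborel_linear\<close>, the scaling of Lebesgue measure under linear maps; for the
  substitution, from \<open>nn_integral_quad\<close>. The remaining steps are \<open>unitary_lift_fwd\<close>, that a change
  of variables induces a unitary operator, and the pointwise identity \<open>intertwining\<close>.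
\<close>

section \<open>Change of variables for Lebesgue integrals\<close>

lemma nn_integral_lborel_shift:
  fixes g :: "'a::euclidean_space \<Rightarrow> ennreal"
  assumes [measurable]: "g \<in> borel_measurable borel"
  shows "(\<integral>\<^sup>+x. g (x + c) \<partial>lborel) = (\<integral>\<^sup>+x. g x \<partial>lborel)"
proof -
  have "(\<integral>\<^sup>+x. g x \<partial>lborel) = (\<integral>\<^sup>+x. g x \<partial>distr lborel borel ((+) c))"
    by (simp add: lborel_distr_plus)
  also have "\<dots> = (\<integral>\<^sup>+x. g (c + x) \<partial>lborel)"
    by (subst nn_integral_distr) auto
  finally show ?thesis by (simp add: add.commute)
qed

text \<open>An injective linear map scales Lebesgue integrals by a constant. This is the uniqueness
  argument for Haar measure: with \<open>Q\<close> the unit cube, the double integral of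
  $1_Q(y)\, g(Lx + y)$ is evaluated in both orders, using translation invariance. The constant is
  the volume of the preimage of \<open>Q\<close> under $x \mapsto -Lx$; its value is irrelevant below, only its
  finiteness matters.\<close>

lemma nn_integral_lborel_linear:
  fixes L :: "'a::euclidean_space \<Rightarrow> 'a"
  assumes lin: "linear L" and inj: "inj L"
  obtains C :: real where "0 \<le> C"
    "\<And>g :: 'a \<Rightarrow> ennreal. g \<in> borel_measurable borel \<Longrightarrow>
       (\<integral>\<^sup>+x. g (L x) \<partial>lborel) = ennreal C * (\<integral>\<^sup>+x. g x \<partial>lborel)"
proof -
  define Q :: "'a set" where "Q = cbox 0 One"
  define q where "q = emeasure lborel {x. - L x \<in> Q}"
  obtain L' where L': "linear L'" "\<And>x. L (L' x) = x" "\<And>x. L' (L x) = x"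
    using linear_injective_isomorphism[OF lin inj] by metis
  have Lm [measurable]: "L \<in> borel_measurable borel"
    using lin by (intro borel_measurable_continuous_onI linear_continuous_on)
      (simp add: linear_conv_bounded_linear)
  have Qm [measurable]: "Q \<in> sets borel" unfolding Q_def by simp
  have Q1: "emeasure lborel Q = 1"
    unfolding Q_def by (subst emeasure_lborel_cbox) (auto simp: inner_diff_left)
  have "{x. - L x \<in> Q} = L' ` ((\<lambda>y. - y) ` Q)"
  proof (intro equalityI subsetI)
    fix x assume "x \<in> {x. - L x \<in> Q}"
    then show "x \<in> L' ` ((\<lambda>y. - y) ` Q)"
      using L'(3)[of x] by (metis (no_types, lifting) imageI mem_Collect_eq minus_minus)
  qed (auto simp: L'(2))
  moreover have "bounded (L' ` ((\<lambda>y. - y) ` Q))"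
    unfolding Q_def using L'(1)
    by (intro bounded_linear_image bounded_uminus) (auto simp: linear_conv_bounded_linear
         intro: bounded_linear_minus bounded_linear_ident)
  ultimately have qfin: "q < \<infinity>"
    unfolding q_def using emeasure_bounded_finite[of "{x. - L x \<in> Q}"] by simp
  have main: "(\<integral>\<^sup>+x. g (L x) \<partial>lborel) = ennreal (enn2real q) * (\<integral>\<^sup>+x. g x \<partial>lborel)"
    if [measurable]: "g \<in> borel_measurable borel" for g :: "'a \<Rightarrow> ennreal"
  proof -
    have "(\<integral>\<^sup>+y. (\<integral>\<^sup>+x. indicator Q y * g (L x + y) \<partial>lborel) \<partial>lborel) =
          (\<integral>\<^sup>+y. indicator Q y * (\<integral>\<^sup>+x. g (L x) \<partial>lborel) \<partial>lborel)"
    proof (rule nn_integral_cong)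
      fix y
      have "(\<integral>\<^sup>+x. g (L x + y) \<partial>lborel) = (\<integral>\<^sup>+x. g (L (x + L' y)) \<partial>lborel)"
        by (simp add: linear_add[OF lin] L')
      also have "\<dots> = (\<integral>\<^sup>+x. g (L x) \<partial>lborel)"
        by (rule nn_integral_lborel_shift[where g = "\<lambda>x. g (L x)"]) simp
      finally show "(\<integral>\<^sup>+x. indicator Q y * g (L x + y) \<partial>lborel) =
          indicator Q y * (\<integral>\<^sup>+x. g (L x) \<partial>lborel)"
        by (simp add: nn_integral_cmult)
    qed
    also have "\<dots> = (\<integral>\<^sup>+x. g (L x) \<partial>lborel)"
      by (simp add: nn_integral_multc Q1)
    finally have 1: "(\<integral>\<^sup>+y. (\<integral>\<^sup>+x. indicator Q y * g (L x + y) \<partial>lborel) \<partial>lborel) =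
        (\<integral>\<^sup>+x. g (L x) \<partial>lborel)" .
    have "(\<integral>\<^sup>+y. (\<integral>\<^sup>+x. indicator Q y * g (L x + y) \<partial>lborel) \<partial>lborel) =
          (\<integral>\<^sup>+x. (\<integral>\<^sup>+y. indicator Q y * g (L x + y) \<partial>lborel) \<partial>lborel)"
      by (intro lborel_pair.Fubini') measurable
    also have "\<dots> = (\<integral>\<^sup>+x. (\<integral>\<^sup>+y. indicator Q (y - L x) * g y \<partial>lborel) \<partial>lborel)"
    proof (rule nn_integral_cong)
      fix x
      show "(\<integral>\<^sup>+y. indicator Q y * g (L x + y) \<partial>lborel) =
            (\<integral>\<^sup>+y. indicator Q (y - L x) * g y \<partial>lborel)"
        using nn_integral_lborel_shift[where g = "\<lambda>y. indicator Q (y - L x) * g y" and c = "L x"]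
        by (simp add: add.commute)
    qed
    also have "\<dots> = (\<integral>\<^sup>+y. (\<integral>\<^sup>+x. indicator Q (y - L x) * g y \<partial>lborel) \<partial>lborel)"
      by (intro lborel_pair.Fubini') measurable
    also have "\<dots> = (\<integral>\<^sup>+y. q * g y \<partial>lborel)"
    proof (rule nn_integral_cong)
      fix y
      have "(\<integral>\<^sup>+x. indicator Q (y - L x) \<partial>lborel) =
            (\<integral>\<^sup>+x. indicator Q (y - L (x + L' y)) \<partial>lborel)"
        by (rule nn_integral_lborel_shift[where g = "\<lambda>x. indicator Q (y - L x)", symmetric]) simp
      also have "\<dots> = (\<integral>\<^sup>+x. indicator {x. - L x \<in> Q} x \<partial>lborel)"
        by (intro nn_integral_cong) (simp add: linear_add[OF lin] L' indicator_def)
      also have "\<dots> = q" by (simp add: q_def)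
      finally show "(\<integral>\<^sup>+x. indicator Q (y - L x) * g y \<partial>lborel) = q * g y"
        by (simp add: nn_integral_multc)
    qed
    also have "\<dots> = q * (\<integral>\<^sup>+x. g x \<partial>lborel)"
      by (simp add: nn_integral_cmult)
    finally show ?thesis using 1 qfin by simp
  qed
  show ?thesis by (rule that[of "enn2real q"]) (auto simp: main)
qed

lemma nn_integral_lborel_scale:
  fixes g :: "'a::euclidean_space \<Rightarrow> ennreal"
  assumes [measurable]: "g \<in> borel_measurable borel" and "c \<noteq> 0"
  shows "(\<integral>\<^sup>+x. g x \<partial>lborel) = ennreal (\<bar>c\<bar> ^ DIM('a)) * (\<integral>\<^sup>+x. g (c *\<^sub>R x) \<partial>lborel)"
  by (subst lborel_affine[OF \<open>c \<noteq> 0\<close>, of 0])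
     (simp add: nn_integral_density nn_integral_distr nn_integral_cmult)

text \<open>The substitution $r = u^2/2$ on either half-line; \<open>s\<close> is a sign.\<close>

lemma nn_integral_half_square:
  fixes g :: "real \<Rightarrow> ennreal" and s :: real
  assumes [measurable]: "g \<in> borel_measurable borel" and s: "\<bar>s\<bar> = 1"
  shows "(\<integral>\<^sup>+u. indicator {0<..} (s * u) * ennreal \<bar>u\<bar> * g (u\<^sup>2 / 2) \<partial>lborel) =
    (\<integral>\<^sup>+r. indicator {0<..} r * g r \<partial>lborel)"
proof -
  have "(\<integral>\<^sup>+u. indicator {0<..} (s * u) * ennreal \<bar>u\<bar> * g (u\<^sup>2 / 2) \<partial>lborel) =
      (\<integral>\<^sup>+u. indicator {0<..} u * ennreal \<bar>u\<bar> * g (u\<^sup>2 / 2) \<partial>lborel)"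
  proof -
    have "(\<integral>\<^sup>+u. indicator {0<..} u * ennreal \<bar>u\<bar> * g (u\<^sup>2 / 2) \<partial>lborel) =
      \<bar>s\<bar> * (\<integral>\<^sup>+u. indicator {0<..} (0 + s * u) * ennreal \<bar>0 + s * u\<bar> * g ((0 + s * u)\<^sup>2 / 2) \<partial>lborel)"
      by (rule nn_integral_real_affine) (use s in auto)
    moreover have "s\<^sup>2 = 1" using s by (metis power2_abs power_one)
    ultimately show ?thesis using s by (simp add: abs_mult power_mult_distrib)
  qed
  \<comment> \<open>The substitution rule concerns compact intervals, so the half-line is exhausted by \<open>{0..1 + N}\<close>.\<close>
  also have "\<dots> = (\<integral>\<^sup>+u. (SUP N::nat. g (u\<^sup>2 / 2) * ennreal u * indicator {0..1 + real N} u) \<partial>lborel)"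
  proof (rule nn_integral_cong)
    fix u :: real
    obtain M :: nat where M: "u \<le> real M" using real_arch_simple by blast
    show "indicator {0<..} u * ennreal \<bar>u\<bar> * g (u\<^sup>2 / 2) =
      (SUP N::nat. g (u\<^sup>2 / 2) * ennreal u * indicator {0..1 + real N} u)"
    proof (cases "u > 0")
      case True
      show ?thesis
      proof (rule antisym)
        show "indicator {0<..} u * ennreal \<bar>u\<bar> * g (u\<^sup>2 / 2) \<le>
          (SUP N::nat. g (u\<^sup>2 / 2) * ennreal u * indicator {0..1 + real N} u)"
          by (rule SUP_upper2[of M]) (use True M in \<open>auto simp: mult_ac\<close>)
        show "(SUP N::nat. g (u\<^sup>2 / 2) * ennreal u * indicator {0..1 + real N} u) \<le>
          indicator {0<..} u * ennreal \<bar>u\<bar> * g (u\<^sup>2 / 2)"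
          by (rule SUP_least) (use True in \<open>auto simp: mult_ac split: split_indicator\<close>)
      qed
    next
      case False
      then have "ennreal u = 0" by (simp add: ennreal_neg)
      then show ?thesis using False by simp
    qed
  qed
  also have "\<dots> = (SUP N::nat. \<integral>\<^sup>+u. g (u\<^sup>2 / 2) * ennreal u * indicator {0..1 + real N} u \<partial>lborel)"
    by (rule nn_integral_monotone_convergence_SUP)
       (auto simp: incseq_def le_fun_def split: split_indicator)
  also have "\<dots> = (SUP N::nat. \<integral>\<^sup>+r. g r * indicator {0..(1 + real N)\<^sup>2 / 2} r \<partial>lborel)"
  proof (rule SUP_cong[OF refl])
    fix N :: nat
    show "(\<integral>\<^sup>+u. g (u\<^sup>2 / 2) * ennreal u * indicator {0..1 + real N} u \<partial>lborel) =
      (\<integral>\<^sup>+r. g r * indicator {0..(1 + real N)\<^sup>2 / 2} r \<partial>lborel)"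
    proof -
      have "((\<lambda>u. u\<^sup>2 / 2) has_real_derivative u) (at u)" for u :: real
        by (auto intro!: derivative_eq_intros)
      then have "(\<integral>\<^sup>+r. g r * indicator {0\<^sup>2 / 2..(1 + real N)\<^sup>2 / 2} r \<partial>lborel) =
          (\<integral>\<^sup>+u. g (u\<^sup>2 / 2) * ennreal u * indicator {0..1 + real N} u \<partial>lborel)"
        by (intro nn_integral_substitution_aux) (auto intro: continuous_intros)
      then show ?thesis by simp
    qed
  qed
  also have "\<dots> = (\<integral>\<^sup>+r. (SUP N::nat. g r * indicator {0..(1 + real N)\<^sup>2 / 2} r) \<partial>lborel)"
  proof (rule nn_integral_monotone_convergence_SUP[symmetric])
    show "incseq (\<lambda>N r. g r * indicator {0..(1 + real N)\<^sup>2 / 2} r)"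
    proof (intro monoI le_funI mult_left_mono)
      fix i j :: nat and r :: real
      assume "i \<le> j"
      then have "(1 + real i)\<^sup>2 \<le> (1 + real j)\<^sup>2"
        by (intro power_mono) auto
      then have "{0..(1 + real i)\<^sup>2 / 2} \<subseteq> {0..(1 + real j)\<^sup>2 / 2}"
        by simp
      moreover have "(indicator S r :: ennreal) \<le> indicator S' r" if "S \<subseteq> S'" for S S'
        using that by (auto split: split_indicator)
      ultimately show "(indicator {0..(1 + real i)\<^sup>2 / 2} r :: ennreal) \<le>
          indicator {0..(1 + real j)\<^sup>2 / 2} r"
        by blast
    qed simp
  qed auto
  also have "\<dots> = (\<integral>\<^sup>+r. indicator {0<..} r * g r \<partial>lborel)"
  proof (rule nn_integral_cong_AE)
    have "(SUP N::nat. g r * indicator {0..(1 + real N)\<^sup>2 / 2} r) = indicator {0<..} r * g r"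
      if "r \<noteq> 0" for r :: real
    proof -
      obtain M :: nat where M: "r \<le> real M" using real_arch_simple by blast
      have "2 * real M \<le> (1 + real M)\<^sup>2" by (simp add: power2_eq_square algebra_simps)
      with M have M': "r \<le> (1 + real M)\<^sup>2 / 2" by simp
      show ?thesis
      proof (cases "r > 0")
        case True
        show ?thesis
        proof (rule antisym)
          show "indicator {0<..} r * g r \<le> (SUP N::nat. g r * indicator {0..(1 + real N)\<^sup>2 / 2} r)"
            by (rule SUP_upper2[of M]) (use True M' in auto)
          show "(SUP N::nat. g r * indicator {0..(1 + real N)\<^sup>2 / 2} r) \<le> indicator {0<..} r * g r"
            by (rule SUP_least) (use True in \<open>auto split: split_indicator\<close>)
        qed
      next
        case False
        with that show ?thesis by simp
      qed
    qed
    then show "AE r in lborel. (SUP N::nat. g r * indicator {0..(1 + real N)\<^sup>2 / 2} r) =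
        indicator {0<..} r * g r"
      using AE_lborel_singleton[of "0::real"] by auto
  qed
  finally show ?thesis .
qed

text \<open>For a sign \<open>s\<close>, the half-space of the points whose first coordinate has sign \<open>s\<close>: this is
  $\mathcal{O}_+ = \mathcal{U}_+$ for \<open>s = 1\<close> and $\mathcal{U}_-$ for \<open>s = - 1\<close>.\<close>

definition side :: "real \<Rightarrow> (real \<times> 'a::euclidean_space) set" where
  "side s = {(u, v). s * u > 0}"

lemma side_borel [measurable]: "side s \<in> sets borel"
proof -
  have "open {w :: real \<times> 'a. 0 < s * fst w}"
    by (intro open_Collect_less continuous_intros)
  then show ?thesis by (simp add: side_def case_prod_unfold)
qed

text \<open>The substitution $(r, \xi) = (u^2/2,\, u v)$.\<close>

definition quad :: "real \<times> 'a::euclidean_space \<Rightarrow> real \<times> 'a" where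
  "quad = (\<lambda>(u, v). (u\<^sup>2 / 2, u *\<^sub>R v))"

lemma quad_borel [measurable]: "quad \<in> borel_measurable borel"
  unfolding quad_def case_prod_unfold
  by (intro borel_measurable_continuous_onI) (auto intro!: continuous_intros)

text \<open>The Jacobian of this substitution is $|u|^{n+1}$: for fixed \<open>u\<close>, scaling by \<open>u\<close> in
  dimension $n$ contributes $|u|^n$, and $u \mapsto u^2/2$ contributes $|u|$.\<close>

lemma nn_integral_quad:
  fixes g :: "real \<times> 'a::euclidean_space \<Rightarrow> ennreal"
  assumes [measurable]: "g \<in> borel_measurable borel" and s: "\<bar>s\<bar> = 1"
  shows "(\<integral>\<^sup>+w. indicator (side s) w * ennreal (\<bar>fst w\<bar> ^ (DIM('a) + 1)) * g (quad w) \<partial>lborel) =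
    (\<integral>\<^sup>+w. indicator (side 1) w * g w \<partial>lborel)"
proof -
  have [measurable]: "(fst :: real \<times> 'a \<Rightarrow> real) \<in> borel_measurable borel"
    by (intro borel_measurable_continuous_onI continuous_intros)
  have gm: "g \<in> borel_measurable (lborel \<Otimes>\<^sub>M lborel)"
    by (simp add: lborel_prod)
  have "(\<lambda>w. indicator (side 1) w * g w) \<in> borel_measurable borel"
    by measurable
  then have hm: "(\<lambda>w. indicator (side 1) w * g w) \<in> borel_measurable (lborel \<Otimes>\<^sub>M lborel)"
    by (simp only: lborel_prod measurable_lborel2)
  have "(\<lambda>w. indicator (side s) w * ennreal (\<bar>fst w\<bar> ^ (DIM('a) + 1)) * g (quad w))
      \<in> borel_measurable borel"
    by measurable
  then have fm: "(\<lambda>w. indicator (side s) w * ennreal (\<bar>fst w\<bar> ^ (DIM('a) + 1)) * g (quad w))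
      \<in> borel_measurable (lborel \<Otimes>\<^sub>M lborel)"
    by (simp only: lborel_prod measurable_lborel2)
  have "(\<integral>\<^sup>+w. indicator (side s) w * ennreal (\<bar>fst w\<bar> ^ (DIM('a) + 1)) * g (quad w) \<partial>lborel) =
    (\<integral>\<^sup>+u. \<integral>\<^sup>+v. indicator (side s) (u, v) * ennreal (\<bar>u\<bar> ^ (DIM('a) + 1)) * g (quad (u, v)) \<partial>lborel \<partial>lborel)"
    using lborel.nn_integral_fst[OF fm] by (simp add: lborel_prod)
  also have "\<dots> = (\<integral>\<^sup>+u. indicator {0<..} (s * u) * ennreal \<bar>u\<bar> * (\<integral>\<^sup>+\<xi>. g (u\<^sup>2 / 2, \<xi>) \<partial>lborel) \<partial>lborel)"
  proof (rule nn_integral_cong)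
    fix u :: real
    show "(\<integral>\<^sup>+v. indicator (side s) (u, v) * ennreal (\<bar>u\<bar> ^ (DIM('a) + 1)) * g (quad (u, v)) \<partial>lborel) =
      indicator {0<..} (s * u) * ennreal \<bar>u\<bar> * (\<integral>\<^sup>+\<xi>. g (u\<^sup>2 / 2, \<xi>) \<partial>lborel)"
    proof (cases "u = 0")
      case False
      have "(\<integral>\<^sup>+v. indicator (side s) (u, v) * ennreal (\<bar>u\<bar> ^ (DIM('a) + 1)) * g (quad (u, v)) \<partial>lborel) =
        indicator {0<..} (s * u) * ennreal \<bar>u\<bar> *
          (ennreal (\<bar>u\<bar> ^ DIM('a)) * (\<integral>\<^sup>+v. g (u\<^sup>2 / 2, u *\<^sub>R v) \<partial>lborel))"
        by (simp add: side_def quad_def indicator_def nn_integral_cmult ennreal_mult mult_ac)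
      also have "ennreal (\<bar>u\<bar> ^ DIM('a)) * (\<integral>\<^sup>+v. g (u\<^sup>2 / 2, u *\<^sub>R v) \<partial>lborel) =
          (\<integral>\<^sup>+\<xi>. g (u\<^sup>2 / 2, \<xi>) \<partial>lborel)"
        by (rule nn_integral_lborel_scale[symmetric]) (use False in auto)
      finally show ?thesis .
    qed (simp add: side_def)
  qed
  also have "\<dots> = (\<integral>\<^sup>+r. indicator {0<..} r * (\<integral>\<^sup>+\<xi>. g (r, \<xi>) \<partial>lborel) \<partial>lborel)"
    by (rule nn_integral_half_square[OF _ s])
       (use lborel.borel_measurable_nn_integral_fst[OF gm] in simp)
  also have "\<dots> = (\<integral>\<^sup>+r. \<integral>\<^sup>+\<xi>. indicator (side 1) (r, \<xi>) * g (r, \<xi>) \<partial>lborel \<partial>lborel)"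
    by (intro nn_integral_cong) (simp add: side_def indicator_def)
  also have "\<dots> = (\<integral>\<^sup>+w. indicator (side 1) w * g w \<partial>lborel)"
    using lborel.nn_integral_fst[OF hm] by (simp add: lborel_prod)
  finally show ?thesis .
qed

section \<open>Classes of square integrable functions\<close>

lemma square_integrable_iff:
  "f \<in> square_integrable \<longleftrightarrow>
     f \<in> borel_measurable borel \<and> (\<integral>\<^sup>+x. ennreal ((norm (f x))\<^sup>2) \<partial>lborel) < \<infinity>"
  by (auto simp: square_integrable_def integrable_iff_bounded)

lemma square_integrable_bound:
  fixes f :: "'a::euclidean_space \<Rightarrow> complex" and h :: "'a \<Rightarrow> real"
  assumes "f \<in> borel_measurable borel" and "integrable lborel h" and "\<And>x. (norm (f x))\<^sup>2 \<le> h x"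
  shows "f \<in> square_integrable"
proof -
  have "integrable lborel (\<lambda>x. (norm (f x))\<^sup>2)"
  proof (rule Bochner_Integration.integrable_bound[OF assms(2)])
    show "AE x in lborel. norm ((norm (f x))\<^sup>2) \<le> norm (h x)"
      using assms(3) by (intro AE_I2) (metis abs_ge_self abs_power2 order_trans real_norm_def)
  qed (use assms(1) in simp)
  then show ?thesis
    using assms(1) by (simp add: square_integrable_def)
qed

lemma square_integrable_add:
  assumes "f \<in> square_integrable" "g \<in> square_integrable"
  shows "(\<lambda>x. f x + g x) \<in> square_integrable"
proof (rule square_integrable_bound)
  show "(\<lambda>x. f x + g x) \<in> borel_measurable borel"
    using assms by (auto simp: square_integrable_def)
  show "integrable lborel (\<lambda>x. 2 * (norm (f x))\<^sup>2 + 2 * (norm (g x))\<^sup>2)"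
    using assms by (auto simp: square_integrable_def)
  fix x
  have "(norm (f x + g x))\<^sup>2 \<le> (norm (f x) + norm (g x))\<^sup>2"
    by (intro power_mono norm_triangle_ineq) simp
  also have "\<dots> \<le> 2 * (norm (f x))\<^sup>2 + 2 * (norm (g x))\<^sup>2"
    using zero_le_power2[of "norm (f x) - norm (g x)"]
    by (simp add: power2_eq_square algebra_simps)
  finally show "(norm (f x + g x))\<^sup>2 \<le> 2 * (norm (f x))\<^sup>2 + 2 * (norm (g x))\<^sup>2" .
qed

lemma square_integrable_scale:
  assumes "f \<in> square_integrable"
  shows "(\<lambda>x. c * f x) \<in> square_integrable"
  using assms by (auto simp: square_integrable_def norm_mult power_mult_distrib)

lemma equiv_ae_eq: "equiv square_integrable ae_eq"
  by (rule equivI) (auto simp: ae_eq_def refl_on_def sym_def trans_def elim: AE_mp)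

lemma l2_class_eq_iff:
  assumes "f \<in> square_integrable" "g \<in> square_integrable"
  shows "l2_class f = l2_class g \<longleftrightarrow> (AE x in lborel. f x = g x)"
  using eq_equiv_class_iff[OF equiv_ae_eq assms] assms by (auto simp: l2_class_def ae_eq_def)

lemma l2_class_in_L2: "f \<in> square_integrable \<Longrightarrow> l2_class f \<in> L2"
  unfolding L2_def l2_class_def by (rule quotientI)

lemma l2_rep_class:
  assumes "f \<in> square_integrable"
  shows "l2_rep (l2_class f) \<in> square_integrable" "AE x in lborel. l2_rep (l2_class f) x = f x"
proof -
  have "f \<in> l2_class f"
    using assms by (auto simp: l2_class_def ae_eq_def)
  then have "l2_rep (l2_class f) \<in> l2_class f"
    unfolding l2_rep_def by (rule someI[where P = "\<lambda>g. g \<in> l2_class f"])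
  then show "l2_rep (l2_class f) \<in> square_integrable" "AE x in lborel. l2_rep (l2_class f) x = f x"
    by (auto simp: l2_class_def ae_eq_def)
qed

lemma l2_add_class:
  assumes "f \<in> square_integrable" "g \<in> square_integrable"
  shows "l2_add (l2_class f) (l2_class g) = l2_class (\<lambda>x. f x + g x)"
  unfolding l2_add_def using l2_rep_class[OF assms(1)] l2_rep_class[OF assms(2)] assms
  by (subst l2_class_eq_iff) (auto intro: square_integrable_add)

lemma l2_scale_class:
  assumes "f \<in> square_integrable"
  shows "l2_scale c (l2_class f) = l2_class (\<lambda>x. c * f x)"
  unfolding l2_scale_def using l2_rep_class[OF assms] assms
  by (subst l2_class_eq_iff) (auto intro: square_integrable_scale)

lemma borel_measurable_cnj [measurable]: "cnj \<in> borel_measurable borel"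
  by (intro borel_measurable_continuous_onI continuous_intros)

lemma l2_inner_class:
  assumes "f \<in> square_integrable" "g \<in> square_integrable"
  shows "l2_inner (l2_class f) (l2_class g) = (LINT x|lborel. f x * cnj (g x))"
  unfolding l2_inner_def
proof (rule integral_cong_AE)
  have "(\<lambda>x. u x * cnj (v x)) \<in> borel_measurable lborel"
    if "u \<in> square_integrable" "v \<in> square_integrable" for u v :: "'a \<Rightarrow> complex"
  proof -
    have [measurable]: "u \<in> borel_measurable borel" "v \<in> borel_measurable borel"
      using that by (auto simp: square_integrable_def)
    show ?thesis by measurable
  qed
  then show "(\<lambda>x. l2_rep (l2_class f) x * cnj (l2_rep (l2_class g) x)) \<in> borel_measurable lborel"
    "(\<lambda>x. f x * cnj (g x)) \<in> borel_measurable lborel"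
    using l2_rep_class assms by blast+
  show "AE x in lborel. l2_rep (l2_class f) x * cnj (l2_rep (l2_class g) x) = f x * cnj (g x)"
    using l2_rep_class(2)[OF assms(1)] l2_rep_class(2)[OF assms(2)] by auto
qed

lemma l2_class_in_L2_on:
  assumes "f \<in> square_integrable" "\<And>x. x \<notin> S \<Longrightarrow> f x = 0"
  shows "l2_class f \<in> L2_on S"
proof -
  have "AE x in lborel. x \<notin> S \<longrightarrow> g x = 0" if "g \<in> l2_class f" for g
  proof -
    have "AE x in lborel. f x = g x"
      using that by (auto simp: l2_class_def ae_eq_def)
    then show ?thesis by eventually_elim (use assms(2) in metis)
  qed
  then show ?thesis
    using l2_class_in_L2[OF assms(1)] by (auto simp: L2_on_def)
qed

text \<open>Each class in $L^2(S)$ has a representative vanishing everywhere off \<open>S\<close>, so that operators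
  on the subspace may be studied pointwise.\<close>

lemma L2_onE:
  fixes S :: "'a::euclidean_space set"
  assumes "F \<in> L2_on S" and S [measurable]: "S \<in> sets borel"
  obtains f where "f \<in> square_integrable" "\<And>x. x \<notin> S \<Longrightarrow> f x = 0" "F = l2_class f"
proof -
  from assms(1) obtain h where h: "h \<in> square_integrable" "F = l2_class h"
    by (auto simp: L2_on_def L2_def l2_class_def elim!: quotientE)
  then have "h \<in> F"
    by (auto simp: l2_class_def ae_eq_def)
  with assms(1) have hS: "AE x in lborel. x \<notin> S \<longrightarrow> h x = 0"
    by (auto simp: L2_on_def)
  define f where "f x = indicator S x * h x" for x
  have [measurable]: "h \<in> borel_measurable borel"
    using h(1) by (simp add: square_integrable_def)
  have f: "f \<in> square_integrable"
  proof (rule square_integrable_bound)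
    show "integrable lborel (\<lambda>x. (norm (h x))\<^sup>2)"
      using h(1) by (simp add: square_integrable_def)
    show "f \<in> borel_measurable borel"
      unfolding f_def by measurable
  qed (simp add: f_def indicator_def)
  moreover have "F = l2_class f"
    unfolding h(2) l2_class_eq_iff[OF h(1) f] using hS
    by eventually_elim (auto simp: f_def indicator_def)
  ultimately show ?thesis
    by (intro that[of f]) (auto simp: f_def)
qed

section \<open>Weighted composition operators\<close>

text \<open>The operator $f \mapsto w \cdot (f \circ \varphi)$.\<close>

definition weighted_comp ::
  "('a::euclidean_space \<Rightarrow> complex) \<Rightarrow> ('a \<Rightarrow> 'a) \<Rightarrow> ('a \<Rightarrow> complex) \<Rightarrow> 'a \<Rightarrow> complex" where
  "weighted_comp w \<phi> f = (\<lambda>x. w x * f (\<phi> x))"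

text \<open>Borel data \<open>w\<close>, \<open>\<phi>\<close> for which the weighted composition operator is bounded on $L^2$. The
  bound is stated for the measure $|w|^2 dx$ pushed forward along \<open>\<phi>\<close>, as a bound on integrals of
  all nonnegative Borel functions; a negative \<open>C\<close> counts as zero.\<close>

definition l2_bounded :: "('a::euclidean_space \<Rightarrow> complex) \<Rightarrow> ('a \<Rightarrow> 'a) \<Rightarrow> bool" where
  "l2_bounded w \<phi> \<longleftrightarrow> w \<in> borel_measurable borel \<and> \<phi> \<in> borel_measurable borel \<and>
     (\<exists>C::real. \<forall>g \<in> borel_measurable borel.
        (\<integral>\<^sup>+x. ennreal ((norm (w x))\<^sup>2) * g (\<phi> x) \<partial>lborel) \<le> ennreal C * (\<integral>\<^sup>+x. g x \<partial>lborel))"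

lemma l2_boundedI:
  fixes C :: real
  assumes "w \<in> borel_measurable borel" "\<phi> \<in> borel_measurable borel"
    and "\<And>g. g \<in> borel_measurable borel \<Longrightarrow>
        (\<integral>\<^sup>+x. ennreal ((norm (w x))\<^sup>2) * g (\<phi> x) \<partial>lborel) \<le> ennreal C * (\<integral>\<^sup>+x. g x \<partial>lborel)"
  shows "l2_bounded w \<phi>"
  using assms unfolding l2_bounded_def by blast

lemma l2_bounded_zero:
  assumes "\<phi> \<in> borel_measurable borel"
  shows "l2_bounded (\<lambda>_. 0) \<phi>"
  using assms by (intro l2_boundedI[where C = 0]) auto

lemma weighted_comp_norm_bound:
  assumes "l2_bounded w \<phi>"
  obtains C :: real where "\<And>f. f \<in> borel_measurable borel \<Longrightarrow>
    (\<integral>\<^sup>+x. ennreal ((norm (weighted_comp w \<phi> f x))\<^sup>2) \<partial>lborel) \<le>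
      ennreal C * (\<integral>\<^sup>+x. ennreal ((norm (f x))\<^sup>2) \<partial>lborel)"
proof -
  obtain C :: real where C: "\<And>g. g \<in> borel_measurable borel \<Longrightarrow>
        (\<integral>\<^sup>+x. ennreal ((norm (w x))\<^sup>2) * g (\<phi> x) \<partial>lborel) \<le> ennreal C * (\<integral>\<^sup>+x. g x \<partial>lborel)"
    using assms unfolding l2_bounded_def by blast
  show ?thesis
  proof (rule that)
    fix f :: "'a \<Rightarrow> complex" assume "f \<in> borel_measurable borel"
    then show "(\<integral>\<^sup>+x. ennreal ((norm (weighted_comp w \<phi> f x))\<^sup>2) \<partial>lborel) \<le>
      ennreal C * (\<integral>\<^sup>+x. ennreal ((norm (f x))\<^sup>2) \<partial>lborel)"
      using C[of "\<lambda>x. ennreal ((norm (f x))\<^sup>2)"]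
      by (simp add: weighted_comp_def norm_mult power_mult_distrib ennreal_mult)
  qed
qed

lemma weighted_comp_measurable:
  assumes "l2_bounded w \<phi>" and [measurable]: "f \<in> borel_measurable borel"
  shows "weighted_comp w \<phi> f \<in> borel_measurable borel"
proof -
  have [measurable]: "w \<in> borel_measurable borel" "\<phi> \<in> borel_measurable borel"
    using assms(1) by (auto simp: l2_bounded_def)
  show ?thesis unfolding weighted_comp_def by measurable
qed

lemma square_integrable_weighted_comp:
  assumes "l2_bounded w \<phi>" "f \<in> square_integrable"
  shows "weighted_comp w \<phi> f \<in> square_integrable"
proof -
  obtain C :: real where C: "\<And>f. f \<in> borel_measurable borel \<Longrightarrow>
    (\<integral>\<^sup>+x. ennreal ((norm (weighted_comp w \<phi> f x))\<^sup>2) \<partial>lborel) \<le>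
      ennreal C * (\<integral>\<^sup>+x. ennreal ((norm (f x))\<^sup>2) \<partial>lborel)"
    using weighted_comp_norm_bound[OF assms(1)] by blast
  have "(\<integral>\<^sup>+x. ennreal ((norm (weighted_comp w \<phi> f x))\<^sup>2) \<partial>lborel) \<le>
      ennreal C * (\<integral>\<^sup>+x. ennreal ((norm (f x))\<^sup>2) \<partial>lborel)"
    using assms(2) by (intro C) (simp add: square_integrable_iff)
  also have "\<dots> < \<infinity>"
    using assms(2) by (simp add: square_integrable_iff ennreal_mult_less_top)
  finally show ?thesis
    using assms by (simp add: square_integrable_iff weighted_comp_measurable)
qed

text \<open>Applied to the difference of two functions, the norm bound shows that the operator respects
  equality almost everywhere, hence acts on classes.\<close>

lemma AE_weighted_comp_cong:
  assumes bd: "l2_bounded w \<phi>" and [measurable]: "f \<in> borel_measurable borel" "g \<in> borel_measurable borel"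
    and eq: "AE x in lborel. f x = g x"
  shows "AE x in lborel. weighted_comp w \<phi> f x = weighted_comp w \<phi> g x"
proof -
  define d where "d x = f x - g x" for x
  have dm [measurable]: "d \<in> borel_measurable borel"
    unfolding d_def by measurable
  obtain C :: real where C: "\<And>f. f \<in> borel_measurable borel \<Longrightarrow>
    (\<integral>\<^sup>+x. ennreal ((norm (weighted_comp w \<phi> f x))\<^sup>2) \<partial>lborel) \<le>
      ennreal C * (\<integral>\<^sup>+x. ennreal ((norm (f x))\<^sup>2) \<partial>lborel)"
    using weighted_comp_norm_bound[OF bd] by blast
  have "(\<integral>\<^sup>+x. ennreal ((norm (d x))\<^sup>2) \<partial>lborel) = 0"
    by (subst nn_integral_0_iff_AE) (use eq in \<open>auto simp: d_def\<close>)
  with C[OF dm] have "(\<integral>\<^sup>+x. ennreal ((norm (weighted_comp w \<phi> d x))\<^sup>2) \<partial>lborel) = 0"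
    by simp
  moreover have "(\<lambda>x. ennreal ((norm (weighted_comp w \<phi> d x))\<^sup>2)) \<in> borel_measurable lborel"
    using weighted_comp_measurable[OF bd dm] by simp
  ultimately have "AE x in lborel. ennreal ((norm (weighted_comp w \<phi> d x))\<^sup>2) = 0"
    by (simp add: nn_integral_0_iff_AE)
  then show ?thesis
    by eventually_elim (auto simp: weighted_comp_def d_def)
qed

lemma l2_lift_class:
  assumes "l2_bounded w \<phi>" "f \<in> square_integrable"
  shows "l2_lift (weighted_comp w \<phi>) (l2_class f) = l2_class (weighted_comp w \<phi> f)"
proof -
  note rep = l2_rep_class[OF assms(2)]
  have "AE x in lborel. weighted_comp w \<phi> (l2_rep (l2_class f)) x = weighted_comp w \<phi> f x"
    using rep assms by (intro AE_weighted_comp_cong) (simp_all add: square_integrable_iff)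
  then show ?thesis
    unfolding l2_lift_def
    using square_integrable_weighted_comp[OF assms(1)] rep(1) assms(2)
    by (simp add: l2_class_eq_iff)
qed

lemma l2_lift_L2_on:
  assumes "l2_bounded w \<phi>" "S \<in> sets borel" "\<And>x. x \<notin> S \<Longrightarrow> \<phi> x \<notin> S"
  shows "l2_lift (weighted_comp w \<phi>) \<in> L2_on S \<rightarrow> L2_on S"
proof
  fix F assume "F \<in> L2_on S"
  then obtain f where f: "f \<in> square_integrable" "\<And>x. x \<notin> S \<Longrightarrow> f x = 0" "F = l2_class f"
    using assms(2) by (rule L2_onE) blast
  show "l2_lift (weighted_comp w \<phi>) F \<in> L2_on S"
    unfolding f(3) l2_lift_class[OF assms(1) f(1)]
  proof (rule l2_class_in_L2_on)
    show "weighted_comp w \<phi> f x = 0" if "x \<notin> S" for x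
      by (simp add: weighted_comp_def f(2) assms(3) that)
  qed (rule square_integrable_weighted_comp[OF assms(1) f(1)])
qed

section \<open>The unitary operator of a change of variables\<close>

text \<open>A Borel bijection \<open>\<Psi>\<close> from \<open>X\<close> to \<open>Y\<close> with inverse \<open>\<Phi>\<close> and Jacobian \<open>J\<close>. The maps are
  total; their values off \<open>X\<close> and \<open>Y\<close> are arbitrary.\<close>

locale change_of_variables =
  fixes X Y :: "'a::euclidean_space set" and \<Psi> \<Phi> :: "'a \<Rightarrow> 'a" and J :: "'a \<Rightarrow> real"
  assumes X_borel [measurable]: "X \<in> sets borel"
    and Y_borel [measurable]: "Y \<in> sets borel"
    and \<Psi>_borel [measurable]: "\<Psi> \<in> borel_measurable borel"
    and \<Phi>_borel [measurable]: "\<Phi> \<in> borel_measurable borel"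
    and J_borel [measurable]: "J \<in> borel_measurable borel"
    and J_pos: "x \<in> X \<Longrightarrow> J x > 0"
    and \<Psi>_in: "x \<in> X \<Longrightarrow> \<Psi> x \<in> Y"
    and \<Phi>_in: "y \<in> Y \<Longrightarrow> \<Phi> y \<in> X"
    and \<Phi>_\<Psi>: "x \<in> X \<Longrightarrow> \<Phi> (\<Psi> x) = x"
    and \<Psi>_\<Phi>: "y \<in> Y \<Longrightarrow> \<Psi> (\<Phi> y) = y"
    and nn_integral_change: "g \<in> borel_measurable borel \<Longrightarrow>
      (\<integral>\<^sup>+x. indicator X x * ennreal (J x) * g (\<Psi> x) \<partial>lborel) =
      (\<integral>\<^sup>+y. indicator Y y * g y \<partial>lborel)"
begin

text \<open>The operators between functions on \<open>X\<close> and functions on \<open>Y\<close>, extended by zero. On functions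
  vanishing off \<open>X\<close> and off \<open>Y\<close>, respectively, they are mutually inverse isometries.\<close>

definition fwd :: "('a \<Rightarrow> complex) \<Rightarrow> 'a \<Rightarrow> complex" where
  "fwd = weighted_comp (\<lambda>y. complex_of_real (indicator Y y / sqrt (J (\<Phi> y)))) \<Phi>"

definition bwd :: "('a \<Rightarrow> complex) \<Rightarrow> 'a \<Rightarrow> complex" where
  "bwd = weighted_comp (\<lambda>x. complex_of_real (indicator X x * sqrt (J x))) \<Psi>"

lemma fwd_bounded: "l2_bounded (\<lambda>y. complex_of_real (indicator Y y / sqrt (J (\<Phi> y)))) \<Phi>"
proof (rule l2_boundedI[where C = 1])
  fix g :: "'a \<Rightarrow> ennreal" assume [measurable]: "g \<in> borel_measurable borel"
  have "(\<integral>\<^sup>+y. ennreal ((norm (complex_of_real (indicator Y y / sqrt (J (\<Phi> y)))))\<^sup>2) * g (\<Phi> y) \<partial>lborel) =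
      (\<integral>\<^sup>+y. indicator Y y * (ennreal (1 / J (\<Phi> y)) * g (\<Phi> y)) \<partial>lborel)"
  proof (rule nn_integral_cong)
    fix y
    show "ennreal ((norm (complex_of_real (indicator Y y / sqrt (J (\<Phi> y)))))\<^sup>2) * g (\<Phi> y) =
        indicator Y y * (ennreal (1 / J (\<Phi> y)) * g (\<Phi> y))"
      using J_pos[OF \<Phi>_in, of y]
      by (cases "y \<in> Y") (simp_all add: norm_divide power_divide)
  qed
  also have "\<dots> = (\<integral>\<^sup>+x. indicator X x * ennreal (J x) *
      (ennreal (1 / J (\<Phi> (\<Psi> x))) * g (\<Phi> (\<Psi> x))) \<partial>lborel)"
    by (rule nn_integral_change[symmetric]) measurable
  also have "\<dots> \<le> (\<integral>\<^sup>+x. g x \<partial>lborel)"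
  proof (rule nn_integral_mono)
    fix x
    show "indicator X x * ennreal (J x) * (ennreal (1 / J (\<Phi> (\<Psi> x))) * g (\<Phi> (\<Psi> x))) \<le> g x"
    proof (cases "x \<in> X")
      case True
      have "ennreal (J x) * ennreal (1 / J x) = 1"
        using J_pos[OF True] by (simp flip: ennreal_mult)
      then show ?thesis
        using True by (simp add: \<Phi>_\<Psi> mult.assoc[symmetric])
    qed simp
  qed
  finally show "(\<integral>\<^sup>+y. ennreal ((norm (complex_of_real (indicator Y y / sqrt (J (\<Phi> y)))))\<^sup>2) * g (\<Phi> y)
      \<partial>lborel) \<le> ennreal 1 * (\<integral>\<^sup>+x. g x \<partial>lborel)" by simp
qed measurable

lemma bwd_bounded: "l2_bounded (\<lambda>x. complex_of_real (indicator X x * sqrt (J x))) \<Psi>"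
proof (rule l2_boundedI[where C = 1])
  fix g :: "'a \<Rightarrow> ennreal" assume [measurable]: "g \<in> borel_measurable borel"
  have "(\<integral>\<^sup>+x. ennreal ((norm (complex_of_real (indicator X x * sqrt (J x))))\<^sup>2) * g (\<Psi> x) \<partial>lborel) =
      (\<integral>\<^sup>+x. indicator X x * ennreal (J x) * g (\<Psi> x) \<partial>lborel)"
  proof (rule nn_integral_cong)
    fix x
    show "ennreal ((norm (complex_of_real (indicator X x * sqrt (J x))))\<^sup>2) * g (\<Psi> x) =
        indicator X x * ennreal (J x) * g (\<Psi> x)"
      using J_pos[of x] by (cases "x \<in> X") simp_all
  qed
  also have "\<dots> = (\<integral>\<^sup>+y. indicator Y y * g y \<partial>lborel)"
    by (rule nn_integral_change) measurable
  also have "\<dots> \<le> (\<integral>\<^sup>+y. g y \<partial>lborel)"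
    by (intro nn_integral_mono) (simp add: indicator_def)
  finally show "(\<integral>\<^sup>+x. ennreal ((norm (complex_of_real (indicator X x * sqrt (J x))))\<^sup>2) * g (\<Psi> x)
      \<partial>lborel) \<le> ennreal 1 * (\<integral>\<^sup>+x. g x \<partial>lborel)" by simp
qed measurable

text \<open>The hypothesis on nonnegative functions as an equality of measures, which carries it over to
  complex functions.\<close>

lemma distr_density: "distr (density lborel (\<lambda>x. ennreal (indicator X x * J x))) borel \<Psi> =
    density lborel (\<lambda>y. ennreal (indicator Y y))"
proof (rule measure_eqI)
  fix A assume "A \<in> sets (distr (density lborel (\<lambda>x. ennreal (indicator X x * J x))) borel \<Psi>)"
  then have A [measurable]: "A \<in> sets borel" by simp
  have "emeasure (distr (density lborel (\<lambda>x. ennreal (indicator X x * J x))) borel \<Psi>) A =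
      (\<integral>\<^sup>+x. ennreal (indicator X x * J x) * indicator (\<Psi> -` A) x \<partial>lborel)"
    using measurable_sets[OF \<Psi>_borel A]
    by (simp add: emeasure_distr emeasure_density)
  also have "\<dots> = (\<integral>\<^sup>+x. indicator X x * ennreal (J x) * indicator A (\<Psi> x) \<partial>lborel)"
    by (intro nn_integral_cong) (simp add: indicator_def)
  also have "\<dots> = (\<integral>\<^sup>+y. indicator Y y * indicator A y \<partial>lborel)"
    by (rule nn_integral_change) measurable
  also have "\<dots> = emeasure (density lborel (\<lambda>y. ennreal (indicator Y y))) A"
    by (subst emeasure_density) (auto simp: ennreal_indicator)
  finally show "emeasure (distr (density lborel (\<lambda>x. ennreal (indicator X x * J x))) borel \<Psi>) A =
    emeasure (density lborel (\<lambda>y. ennreal (indicator Y y))) A" .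
qed simp

lemma integral_change:
  fixes k :: "'a \<Rightarrow> complex"
  assumes [measurable]: "k \<in> borel_measurable borel"
  shows "(LINT x|lborel. (indicator X x * J x) *\<^sub>R k (\<Psi> x)) = (LINT y|lborel. indicator Y y *\<^sub>R k y)"
proof -
  have "(LINT y|lborel. indicator Y y *\<^sub>R k y) = (LINT y|density lborel (\<lambda>y. ennreal (indicator Y y)). k y)"
    by (subst integral_density) auto
  also have "\<dots> = (LINT x|density lborel (\<lambda>x. ennreal (indicator X x * J x)). k (\<Psi> x))"
    by (subst distr_density[symmetric], subst integral_distr) auto
  also have "\<dots> = (LINT x|lborel. (indicator X x * J x) *\<^sub>R k (\<Psi> x))"
  proof (subst integral_density)
    show "AE x in lborel. 0 \<le> indicator X x * J x"
      using J_pos by (intro AE_I2) (auto simp: indicator_def intro: less_imp_le)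
  qed auto
  finally show ?thesis ..
qed

lemma bwd_fwd:
  assumes "\<And>x. x \<notin> X \<Longrightarrow> f x = 0"
  shows "bwd (fwd f) = f"
proof
  fix x
  show "bwd (fwd f) x = f x"
    using J_pos[of x] assms[of x]
    by (cases "x \<in> X") (auto simp: bwd_def fwd_def weighted_comp_def \<Phi>_\<Psi> \<Psi>_in)
qed

lemma fwd_bwd:
  assumes "\<And>y. y \<notin> Y \<Longrightarrow> f y = 0"
  shows "fwd (bwd f) = f"
proof
  fix y
  show "fwd (bwd f) y = f y"
    using J_pos[OF \<Phi>_in, of y] assms[of y]
    by (cases "y \<in> Y") (auto simp: bwd_def fwd_def weighted_comp_def \<Psi>_\<Phi> \<Phi>_in)
qed

lemma inner_fwd:
  assumes [measurable]: "f \<in> borel_measurable borel" "g \<in> borel_measurable borel"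
    and 0: "\<And>x. x \<notin> X \<Longrightarrow> f x = 0"
  shows "(LINT y|lborel. fwd f y * cnj (fwd g y)) = (LINT x|lborel. f x * cnj (g x))"
proof -
  have fm [measurable]: "fwd f \<in> borel_measurable borel" "fwd g \<in> borel_measurable borel"
    unfolding fwd_def using fwd_bounded assms by (auto intro: weighted_comp_measurable)
  have "(LINT y|lborel. fwd f y * cnj (fwd g y)) =
      (LINT y|lborel. indicator Y y *\<^sub>R (fwd f y * cnj (fwd g y)))"
    by (intro Bochner_Integration.integral_cong) (auto simp: fwd_def weighted_comp_def indicator_def)
  also have "\<dots> = (LINT x|lborel. (indicator X x * J x) *\<^sub>R (fwd f (\<Psi> x) * cnj (fwd g (\<Psi> x))))"
    by (rule integral_change[symmetric]) measurable
  also have "\<dots> = (LINT x|lborel. f x * cnj (g x))"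
  proof (intro Bochner_Integration.integral_cong refl)
    fix x
    show "(indicator X x * J x) *\<^sub>R (fwd f (\<Psi> x) * cnj (fwd g (\<Psi> x))) = f x * cnj (g x)"
    proof (cases "x \<in> X")
      case True
      have "complex_of_real (sqrt (J x)) * complex_of_real (sqrt (J x)) = complex_of_real (J x)"
        using J_pos[OF True] by (simp flip: of_real_mult)
      then show ?thesis
        using True J_pos[OF True]
        by (simp add: fwd_def weighted_comp_def \<Phi>_\<Psi> \<Psi>_in scaleR_conv_of_real field_simps)
    qed (simp add: 0)
  qed
  finally show ?thesis .
qed

lemma fwd_class:
  assumes "f \<in> square_integrable"
  shows "l2_lift fwd (l2_class f) = l2_class (fwd f)" "fwd f \<in> square_integrable"
  using l2_lift_class[OF fwd_bounded assms] square_integrable_weighted_comp[OF fwd_bounded assms]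
  by (simp_all add: fwd_def)

lemma unitary_lift_fwd: "unitary_between (L2_on X) (L2_on Y) (l2_lift fwd)"
proof -
  have bwd_class: "l2_lift bwd (l2_class f) = l2_class (bwd f)" "bwd f \<in> square_integrable"
    if "f \<in> square_integrable" for f
    using l2_lift_class[OF bwd_bounded that] square_integrable_weighted_comp[OF bwd_bounded that]
    by (simp_all add: bwd_def)
  have bij: "bij_betw (l2_lift fwd) (L2_on X) (L2_on Y)"
  proof (rule bij_betw_byWitness[where f' = "l2_lift bwd"])
    show "\<forall>F\<in>L2_on X. l2_lift bwd (l2_lift fwd F) = F"
      by (auto elim!: L2_onE simp: fwd_class bwd_class bwd_fwd)
    show "\<forall>F\<in>L2_on Y. l2_lift fwd (l2_lift bwd F) = F"
      by (auto elim!: L2_onE simp: fwd_class bwd_class fwd_bwd)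
    show "l2_lift fwd ` L2_on X \<subseteq> L2_on Y"
      by (auto elim!: L2_onE simp: fwd_class intro!: l2_class_in_L2_on)
         (auto simp: fwd_def weighted_comp_def)
    show "l2_lift bwd ` L2_on Y \<subseteq> L2_on X"
      by (auto elim!: L2_onE simp: bwd_class intro!: l2_class_in_L2_on)
         (auto simp: bwd_def weighted_comp_def)
  qed
  have lin: "fwd (\<lambda>x. f x + g x) = (\<lambda>y. fwd f y + fwd g y)" "fwd (\<lambda>x. c * f x) = (\<lambda>y. c * fwd f y)"
    for f g :: "'a \<Rightarrow> complex" and c
    by (simp_all add: fwd_def weighted_comp_def ring_distribs add_divide_distrib mult_ac)
  have "l2_lift fwd (l2_add F G) = l2_add (l2_lift fwd F) (l2_lift fwd G) \<and>
      l2_lift fwd (l2_scale c F) = l2_scale c (l2_lift fwd F) \<and>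
      l2_inner (l2_lift fwd F) (l2_lift fwd G) = l2_inner F G"
    if "F \<in> L2_on X" "G \<in> L2_on X" for F G c
  proof -
    from that obtain f g where f: "f \<in> square_integrable" "F = l2_class f" "\<And>x. x \<notin> X \<Longrightarrow> f x = 0"
      and g: "g \<in> square_integrable" "G = l2_class g"
      by (metis L2_onE X_borel)
    have "f \<in> borel_measurable borel" "g \<in> borel_measurable borel"
      using f g by (auto simp: square_integrable_def)
    with f g show ?thesis
      by (simp add: l2_add_class l2_scale_class l2_inner_class fwd_class lin inner_fwd
          square_integrable_add square_integrable_scale)
  qed
  with bij show ?thesis
    unfolding unitary_between_def by blast
qed

end

section \<open>The two representations as weighted compositions\<close>

lemma borel_measurable_fst_snd [measurable]:
  "(fst :: 'a::euclidean_space \<times> 'b::euclidean_space \<Rightarrow> 'a) \<in> borel_measurable borel"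
  "(snd :: 'a \<times> 'b \<Rightarrow> 'b) \<in> borel_measurable borel"
  by (intro borel_measurable_continuous_onI continuous_intros)+

lemma l2_bounded_linear:
  assumes [measurable]: "w \<in> borel_measurable borel" and K: "\<And>x. norm (w x) \<le> K"
    and lin: "linear L" and inj: "inj L"
  shows "l2_bounded w L"
proof -
  obtain C :: real where C: "0 \<le> C"
    "\<And>g :: 'a \<Rightarrow> ennreal. g \<in> borel_measurable borel \<Longrightarrow>
       (\<integral>\<^sup>+x. g (L x) \<partial>lborel) = ennreal C * (\<integral>\<^sup>+x. g x \<partial>lborel)"
    using nn_integral_lborel_linear[OF lin inj] by blast
  have Lm [measurable]: "L \<in> borel_measurable borel"
    using lin by (intro borel_measurable_continuous_onI linear_continuous_on)
      (simp add: linear_conv_bounded_linear)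
  show ?thesis
  proof (rule l2_boundedI[where C = "K\<^sup>2 * C"])
    fix g :: "'a \<Rightarrow> ennreal" assume [measurable]: "g \<in> borel_measurable borel"
    have "(\<integral>\<^sup>+x. ennreal ((norm (w x))\<^sup>2) * g (L x) \<partial>lborel) \<le>
        (\<integral>\<^sup>+x. ennreal (K\<^sup>2) * g (L x) \<partial>lborel)"
      by (intro nn_integral_mono mult_right_mono ennreal_leI power_mono K) auto
    also have "\<dots> = ennreal (K\<^sup>2 * C) * (\<integral>\<^sup>+x. g x \<partial>lborel)"
      using C by (simp add: nn_integral_cmult ennreal_mult mult.assoc)
    finally show "(\<integral>\<^sup>+x. ennreal ((norm (w x))\<^sup>2) * g (L x) \<partial>lborel) \<le>
        ennreal (K\<^sup>2 * C) * (\<integral>\<^sup>+x. g x \<partial>lborel)" .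
  qed measurable
qed

lemma inj_mult_matrix_exp:
  assumes "delta B t \<noteq> 0"
  shows "inj (\<lambda>v. v v* matrix_exp (lin_comb B t))"
proof -
  have "inj ((*v) (transpose (matrix_exp (lin_comb B t))))"
    using assms by (intro inj_matrix_vector_mult) (simp add: delta_def invertible_det_nz)
  then show ?thesis by (simp add: inj_def)
qed

text \<open>The linear changes of the argument in the metaplectic and in the wavelet representation.\<close>

definition metaplectic_map :: "real^2 \<Rightarrow> real^'n^'n^2 \<Rightarrow> 'n gelem \<Rightarrow>
    real \<times> (real^'n) \<Rightarrow> real \<times> (real^'n)" where
  "metaplectic_map p B = (\<lambda>(t, x, y, z) (u, v). (exp ((p \<bullet> t) / 2) * u,
     exp (- (p \<bullet> t) / 2) *\<^sub>R (transpose (matrix_exp (lin_comb B t)) *v ((u / 2) *\<^sub>R y + v))))"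

definition wavelet_map :: "real^2 \<Rightarrow> real^'n^'n^2 \<Rightarrow> 'n gelem \<Rightarrow>
    real \<times> (real^'n) \<Rightarrow> real \<times> (real^'n)" where
  "wavelet_map p B = (\<lambda>(t, x, y, z) (r, \<xi>).
     (r * exp (p \<bullet> t), (r *\<^sub>R y + \<xi>) v* matrix_exp (lin_comb B t)))"

text \<open>The weights of both representations are the images of the constant function 1.\<close>

lemma metaplectic_fun_eq:
  "metaplectic_fun p B g = weighted_comp (metaplectic_fun p B g (\<lambda>_. 1)) (metaplectic_map p B g)"
  by (cases g) (auto simp: fun_eq_iff metaplectic_fun_def metaplectic_map_def weighted_comp_def)

lemma wavelet_fun_eq:
  "wavelet_fun p B g = weighted_comp (wavelet_fun p B g (\<lambda>_. 1)) (wavelet_map p B g)"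
  by (cases g) (auto simp: fun_eq_iff wavelet_fun_def wavelet_map_def weighted_comp_def)

lemma linear_metaplectic_map: "linear (metaplectic_map p B g)"
  by (cases g) (auto intro!: linearI simp: metaplectic_map_def algebra_simps
      scaleR_vector_matrix_assoc add_divide_distrib)

lemma linear_wavelet_map: "linear (wavelet_map p B g)"
  by (cases g) (auto intro!: linearI simp: wavelet_map_def algebra_simps
      scaleR_vector_matrix_assoc)

text \<open>The determinant \<open>delta B t\<close> of an exponential is nonzero, but this need not be known: if it
  vanished, the weight would be zero. Otherwise \<open>metaplectic_map\<close> is injective and the weight has
  constant modulus; the same argument applies to the wavelet representation.\<close>

lemma l2_bounded_metaplectic:
  fixes B :: "real^'n^'n^2"
  shows "l2_bounded (metaplectic_fun p B g (\<lambda>_. 1)) (metaplectic_map p B g)"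
proof -
  obtain t x y z where g: "g = (t, x, y, z)" by (cases g)
  show ?thesis
  proof (cases "delta B t = 0")
    case True
    then have "metaplectic_fun p B g (\<lambda>_. 1) = (\<lambda>_. 0)"
      by (auto simp: fun_eq_iff metaplectic_fun_def g)
    moreover have "metaplectic_map p B g \<in> borel_measurable borel"
      using linear_metaplectic_map
      by (intro borel_measurable_continuous_onI linear_continuous_on)
        (simp add: linear_conv_bounded_linear)
    ultimately show ?thesis by (simp add: l2_bounded_zero)
  next
    case False
    show ?thesis
    proof (rule l2_bounded_linear)
      show "metaplectic_fun p B g (\<lambda>_. 1) \<in> borel_measurable borel"
        unfolding metaplectic_fun_def g case_prod_unfold
        by (intro borel_measurable_continuous_onI) (auto intro!: continuous_intros)
      show "norm (metaplectic_fun p B g (\<lambda>_. 1) w) \<le>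
          \<bar>sqrt (delta B t) * exp ((p \<bullet> t) * (1 - real CARD('n)) / 4)\<bar>" for w
        by (cases w) (simp add: metaplectic_fun_def g norm_mult abs_mult)
      show "inj (metaplectic_map p B g)"
        by (rule injI) (auto simp: metaplectic_map_def g dest!: injD[OF inj_mult_matrix_exp[OF False]])
    qed (rule linear_metaplectic_map)
  qed
qed

lemma l2_bounded_wavelet:
  fixes B :: "real^'n^'n^2"
  shows "l2_bounded (wavelet_fun p B g (\<lambda>_. 1)) (wavelet_map p B g)"
proof -
  obtain t x y z where g: "g = (t, x, y, z)" by (cases g)
  show ?thesis
  proof (cases "delta B t = 0")
    case True
    then have "wavelet_fun p B g (\<lambda>_. 1) = (\<lambda>_. 0)"
      by (auto simp: fun_eq_iff wavelet_fun_def g)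
    moreover have "wavelet_map p B g \<in> borel_measurable borel"
      using linear_wavelet_map
      by (intro borel_measurable_continuous_onI linear_continuous_on)
        (simp add: linear_conv_bounded_linear)
    ultimately show ?thesis by (simp add: l2_bounded_zero)
  next
    case False
    show ?thesis
    proof (rule l2_bounded_linear)
      show "wavelet_fun p B g (\<lambda>_. 1) \<in> borel_measurable borel"
        unfolding wavelet_fun_def g case_prod_unfold
        by (intro borel_measurable_continuous_onI) (auto intro!: continuous_intros)
      show "norm (wavelet_fun p B g (\<lambda>_. 1) w) \<le>
          \<bar>sqrt (delta B t) * exp ((p \<bullet> t) / 2)\<bar>" for w
        by (cases w) (simp add: wavelet_fun_def g norm_mult abs_mult)
      show "inj (wavelet_map p B g)"
        by (rule injI) (auto simp: wavelet_map_def g dest!: injD[OF inj_mult_matrix_exp[OF False]])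
    qed (rule linear_wavelet_map)
  qed
qed

section \<open>The intertwining operator\<close>

text \<open>The inverse of \<open>quad\<close>, from the half-space $r > 0$ to the half-space of sign \<open>s\<close>; its
  values for $r \le 0$ do not matter.\<close>

definition quad_inv :: "real \<Rightarrow> real \<times> 'a::euclidean_space \<Rightarrow> real \<times> 'a" where
  "quad_inv s = (\<lambda>(r, \<xi>). (s * sqrt (2 * r), (s / sqrt (2 * r)) *\<^sub>R \<xi>))"

lemma change_of_variables_quad:
  assumes s: "\<bar>s\<bar> = 1"
  shows "change_of_variables (side s) (side 1) quad (quad_inv s)
    (\<lambda>w :: real \<times> 'a::euclidean_space. \<bar>fst w\<bar> ^ (DIM('a) + 1))"
proof
  have ss: "s * s = 1" using s by (metis abs_mult_self_eq mult_1)
  show "quad_inv s \<in> borel_measurable (borel :: (real \<times> 'a) measure)"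
    unfolding quad_inv_def case_prod_unfold by measurable
  show "(\<lambda>w :: real \<times> 'a. \<bar>fst w\<bar> ^ (DIM('a) + 1)) \<in> borel_measurable borel"
    by measurable
  fix w :: "real \<times> 'a"
  show "\<bar>fst w\<bar> ^ (DIM('a) + 1) > 0" if "w \<in> side s"
    using that by (intro zero_less_power) (auto simp: side_def)
  show "quad w \<in> side 1" if "w \<in> side s"
    using that by (auto simp: side_def quad_def)
  show "quad_inv s w \<in> side s" if "w \<in> side 1"
    using that by (auto simp: side_def quad_inv_def ss mult.assoc[symmetric])
  show "quad_inv s (quad w) = w" if "w \<in> side s"
  proof -
    obtain u v where w: "w = (u, v)" by (cases w)
    have su: "s * u > 0" using that by (simp add: side_def w)
    then have "sqrt (2 * (u\<^sup>2 / 2)) = s * u"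
      using s by (simp add: abs_mult abs_if split: if_splits)
    with su ss show ?thesis
      by (auto simp: w quad_def quad_inv_def mult.assoc[symmetric])
  qed
  show "quad (quad_inv s w) = w" if "w \<in> side 1"
    using that ss by (auto simp: side_def quad_def quad_inv_def power_mult_distrib power2_eq_square[of s])
qed (rule side_borel quad_borel nn_integral_quad[OF _ s] | assumption)+

lemma sqrt_power_mult_exp:
  assumes "0 < q"
  shows "sqrt ((q * exp (a / 2)) ^ m) = sqrt (q ^ m) * exp (a * real m / 4)"
proof -
  have "sqrt (exp (a / 2) ^ m) = exp (a * real m / 4)"
    by (rule real_sqrt_unique) (simp_all add: exp_of_nat_mult[symmetric] power2_eq_square
        exp_add[symmetric] field_simps)
  then show ?thesis by (simp add: power_mult_distrib real_sqrt_mult)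
qed

text \<open>The operator \<open>V\<close> is \<open>fwd\<close> for the change of variables \<open>quad\<close>. The identity holds pointwise,
  for arbitrary functions.\<close>

lemma intertwining:
  fixes f :: "real \<times> (real^'n) \<Rightarrow> complex"
  assumes s: "\<bar>s\<bar> = 1"
  defines "V \<equiv> weighted_comp (\<lambda>w. complex_of_real (indicator (side 1) w /
      sqrt (\<bar>fst (quad_inv s w)\<bar> ^ (DIM(real^'n) + 1)))) (quad_inv s)"
  shows "V (metaplectic_fun p B g f) = wavelet_fun p B g (V f)"
proof
  fix w :: "real \<times> (real^'n)"
  obtain r \<xi> where w: "w = (r, \<xi>)" by (cases w)
  obtain t x y z where g: "g = (t, x, y, z)" by (cases g)
  show "V (metaplectic_fun p B g f) w = wavelet_fun p B g (V f) w"
  proof (cases "r > 0")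
    case False
    then show ?thesis
      by (simp add: V_def weighted_comp_def w g wavelet_fun_def side_def zero_less_mult_iff)
  next
    case True
    define q where "q = sqrt (2 * r)"
    define a where "a = p \<bullet> t"
    define A where "A = matrix_exp (lin_comb B t)"
    define m where "m = CARD('n) + 1"
    have q: "q > 0" and r: "r = q\<^sup>2 / 2"
      using True by (auto simp: q_def)
    have ss: "s * s = 1" using s by (metis abs_mult_self_eq mult_1)
    have sq: "(s * q) * (s / q) = 1"
      using q ss by simp
    have q': "q * exp (a / 2) = sqrt (2 * (r * exp a))"
    proof (rule real_sqrt_unique[symmetric])
      have "(exp (a / 2))\<^sup>2 = exp a"
        by (simp add: power2_eq_square flip: exp_add)
      then show "(q * exp (a / 2))\<^sup>2 = 2 * (r * exp a)"
        by (simp add: power_mult_distrib r)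
    qed (use q in simp)
    \<comment> \<open>\<open>quad\<close> carries the metaplectic change of argument to that of the wavelet representation.\<close>
    have arg: "exp (- a / 2) *\<^sub>R (transpose A *v ((s * q / 2) *\<^sub>R y + (s / q) *\<^sub>R \<xi>)) =
        (s / (q * exp (a / 2))) *\<^sub>R ((r *\<^sub>R y + \<xi>) v* A)"
    proof -
      have "s * q / 2 = (s / q) * r"
        using q by (simp add: r power2_eq_square)
      then have "(s * q / 2) *\<^sub>R y + (s / q) *\<^sub>R \<xi> = (s / q) *\<^sub>R (r *\<^sub>R y + \<xi>)"
        by (simp only: scaleR_add_right scaleR_scaleR)
      then have "transpose A *v ((s * q / 2) *\<^sub>R y + (s / q) *\<^sub>R \<xi>) =
          (s / q) *\<^sub>R ((r *\<^sub>R y + \<xi>) v* A)"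
        by (simp only: transpose_matrix_vector scaleR_vector_matrix_assoc)
      moreover have "exp (- a / 2) * (s / q) = s / (q * exp (a / 2))"
        by (simp add: exp_minus field_simps)
      ultimately show ?thesis
        by (simp only: scaleR_scaleR)
    qed
    have phase: "(s * q)\<^sup>2 * z + 2 * (s * q) * (((s / q) *\<^sub>R \<xi>) \<bullet> x) = 2 * (r * z + \<xi> \<bullet> x)"
    proof -
      have "(s * q)\<^sup>2 = 2 * r"
        using ss by (simp add: power_mult_distrib r power2_eq_square[of s])
      moreover have "(s * q) * (((s / q) *\<^sub>R \<xi>) \<bullet> x) = \<xi> \<bullet> x"
        using sq by (simp only: inner_scaleR_left mult.assoc[symmetric] mult_1)
      ultimately show ?thesis
        by (simp only: mult.assoc distrib_left)
    qed
    \<comment> \<open>At the moved point the weight of \<open>V\<close> has the extra factor \<open>exp (- a * (n + 1) / 4)\<close>, the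
      metaplectic normalization divided by that of the wavelet representation.\<close>
    have factor: "exp (a * (1 - real CARD('n)) / 4) / sqrt (q ^ m) =
        exp (a / 2) / sqrt ((q * exp (a / 2)) ^ m)"
    proof -
      have "exp (a / 2) = exp (a * (1 - real CARD('n)) / 4) * exp (a * real m / 4)"
        by (simp add: exp_add[symmetric] m_def field_simps)
      then show ?thesis
        unfolding sqrt_power_mult_exp[OF q] by simp
    qed
    define F where
      "F = f (exp (a / 2) * (s * q), (s / (q * exp (a / 2))) *\<^sub>R ((r *\<^sub>R y + \<xi>) v* A))"
    have weight: "V h (r', \<xi>') = complex_of_real (1 / sqrt (q' ^ m)) * h (s * q', (s / q') *\<^sub>R \<xi>')"
      if "r' > 0" "q' = sqrt (2 * r')" for h r' \<xi>' q'
      using that s by (simp add: V_def weighted_comp_def side_def quad_inv_def m_def abs_mult)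
    have "V (metaplectic_fun p B g f) w =
        complex_of_real (1 / sqrt (q ^ m)) * metaplectic_fun p B g f (s * q, (s / q) *\<^sub>R \<xi>)"
      unfolding w by (rule weight[OF True q_def])
    also have "metaplectic_fun p B g f (s * q, (s / q) *\<^sub>R \<xi>) =
        complex_of_real (sqrt (delta B t) * exp (a * (1 - real CARD('n)) / 4)) *
         exp (- \<i> * complex_of_real pi * complex_of_real (2 * (r * z + \<xi> \<bullet> x))) * F"
      by (simp only: metaplectic_fun_def g prod.case phase arg F_def flip: a_def A_def)
    also have "complex_of_real (1 / sqrt (q ^ m)) * \<dots> = complex_of_real (sqrt (delta B t)) *
        complex_of_real (exp (a * (1 - real CARD('n)) / 4) / sqrt (q ^ m)) *
         exp (- 2 * \<i> * complex_of_real pi * complex_of_real (r * z + \<xi> \<bullet> x)) * F"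
      by (simp add: mult_ac)
    also have "\<dots> = complex_of_real (sqrt (delta B t) * exp (a / 2)) *
         exp (- 2 * \<i> * complex_of_real pi * complex_of_real (r * z + \<xi> \<bullet> x)) *
         (complex_of_real (1 / sqrt ((q * exp (a / 2)) ^ m)) * F)"
      unfolding factor by simp
    also have "complex_of_real (1 / sqrt ((q * exp (a / 2)) ^ m)) * F =
        V f (r * exp a, (r *\<^sub>R y + \<xi>) v* A)"
    proof -
      have order: "exp (a / 2) * (s * q) = s * (q * exp (a / 2))" by simp
      show ?thesis
        unfolding F_def order by (rule weight[symmetric, OF _ q']) (use True in simp)
    qed
    also have "complex_of_real (sqrt (delta B t) * exp (a / 2)) *
        exp (- 2 * \<i> * complex_of_real pi * complex_of_real (r * z + \<xi> \<bullet> x)) * \<dots> =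
        wavelet_fun p B g (V f) w"
      by (simp only: wavelet_fun_def g w prod.case a_def A_def)
    finally show ?thesis .
  qed
qed

lemma metaplectic_equiv_wavelet:
  fixes B :: "real^'n^'n^2"
  assumes s: "\<bar>s\<bar> = 1"
  shows "unitarily_equivalent (group_G p B)
    (L2_on (side s)) (subrep (metaplectic_rep p B) (L2_on (side s)))
    (L2_on (side 1)) (subrep (wavelet_rep p B) (L2_on (side 1)))"
proof -
  interpret change_of_variables "side s" "side 1" quad "quad_inv s"
      "\<lambda>w :: real \<times> (real^'n). \<bar>fst w\<bar> ^ (DIM(real^'n) + 1)"
    using s by (rule change_of_variables_quad)
  have met_inv: "metaplectic_rep p B g \<in> L2_on (side s) \<rightarrow> L2_on (side s)" for g
    unfolding metaplectic_rep_def
    by (subst metaplectic_fun_eq, rule l2_lift_L2_on[OF l2_bounded_metaplectic side_borel])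
       (cases g, auto simp: side_def metaplectic_map_def zero_less_mult_iff mult_less_0_iff)
  have wav_inv: "wavelet_rep p B g \<in> L2_on (side 1) \<rightarrow> L2_on (side 1)" for g
    unfolding wavelet_rep_def
    by (subst wavelet_fun_eq, rule l2_lift_L2_on[OF l2_bounded_wavelet side_borel])
       (cases g, auto simp: side_def wavelet_map_def zero_less_mult_iff)
  have inter: "l2_lift fwd (metaplectic_rep p B g F) = wavelet_rep p B g (l2_lift fwd F)"
    if F: "F \<in> L2_on (side s)" for g F
  proof -
    from F obtain f where f: "f \<in> square_integrable" "F = l2_class f"
      using side_borel by (rule L2_onE) blast
    have met_f: "metaplectic_fun p B g f \<in> square_integrable"
      by (subst metaplectic_fun_eq)
         (rule square_integrable_weighted_comp[OF l2_bounded_metaplectic f(1)])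
    have "l2_lift fwd (metaplectic_rep p B g F) = l2_lift fwd (l2_class (metaplectic_fun p B g f))"
      unfolding metaplectic_rep_def f(2)
      using l2_lift_class[OF l2_bounded_metaplectic f(1), of p B g]
      by (simp flip: metaplectic_fun_eq)
    also have "\<dots> = l2_class (fwd (metaplectic_fun p B g f))"
      by (rule fwd_class(1)[OF met_f])
    also have "\<dots> = l2_class (wavelet_fun p B g (fwd f))"
      unfolding fwd_def using intertwining[OF s, of p B g f] by simp
    also have "\<dots> = wavelet_rep p B g (l2_class (fwd f))"
      unfolding wavelet_rep_def
      using l2_lift_class[OF l2_bounded_wavelet fwd_class(2)[OF f(1)], of p B g]
      by (simp flip: wavelet_fun_eq)
    also have "l2_class (fwd f) = l2_lift fwd F"
      unfolding f(2) by (rule fwd_class(1)[OF f(1), symmetric])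
    finally show ?thesis .
  qed
  have fwd_in: "l2_lift fwd F \<in> L2_on (side 1)" if "F \<in> L2_on (side s)" for F
    using unitary_lift_fwd that unfolding unitary_between_def by (blast dest: bij_betwE)
  show ?thesis
    unfolding unitarily_equivalent_def subrep_def
  proof (intro conjI ballI exI[of _ "l2_lift fwd"])
    fix g and F :: "(real \<times> (real^'n)) l2"
    assume F: "F \<in> L2_on (side s)"
    show "l2_lift fwd (restrict (metaplectic_rep p B g) (L2_on (side s)) F) =
        restrict (wavelet_rep p B g) (L2_on (side 1)) (l2_lift fwd F)"
      unfolding restrict_apply'[OF F] restrict_apply'[OF fwd_in[OF F]] by (rule inter[OF F])
  next
    show "restrict (metaplectic_rep p B g) (L2_on (side s)) \<in> L2_on (side s) \<rightarrow> L2_on (side s)" for g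
      using met_inv[of g] by (auto simp: Pi_iff)
    show "restrict (wavelet_rep p B g) (L2_on (side 1)) \<in> L2_on (side 1) \<rightarrow> L2_on (side 1)" for g
      using wav_inv[of g] by (auto simp: Pi_iff)
  qed (rule unitary_lift_fwd)
qed

theorem proposition4p1:
  fixes p :: "real^2" and B :: "real^'n^'n^2"
  assumes "B $ 1 ** B $ 2 = B $ 2 ** B $ 1"
    and "cond_M1 p B"
    and "cond_M2 p B"
  shows "unitarily_equivalent (group_G p B)
           (L2_on pos_half) (metaplectic_pos p B) (L2_on pos_half) (wavelet_pos p B) \<and>
         unitarily_equivalent (group_G p B)
           (L2_on neg_half) (metaplectic_neg p B) (L2_on pos_half) (wavelet_pos p B)"
proof -
  have "(pos_half :: (real \<times> (real^'n)) set) = side 1" "(neg_half :: (real \<times> (real^'n)) set) = side (- 1)"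
    by (auto simp: pos_half_def neg_half_def side_def)
  then show ?thesis
    using metaplectic_equiv_wavelet[of 1 p B] metaplectic_equiv_wavelet[of "- 1" p B] by simp
qed

end
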